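(* Let $\alpha, \beta, \gamma \in \mathbb{R}_{\geq 0}$. Let $G$ be a graph whose vertex-set $V(G)$ is partitioned into a sequence of pairwise disjoint sets $X_1, \dots, X_t, X_{t+1}$ (so that their union is $V(G)$) satisfying: (1) $t \leq \alpha$; (2) $|X_{t+1}| \leq \beta$; and (3) for each $i \in \{1,\dots,t\}$, the set $Y_i = \{ v \in X_{i} \cup X_{i+1} \cup \dots \cup X_{t+1} : v \text{ is mixed on } X_i \}$ satisfies $|Y_i| \leq \gamma$. Then the twin-width of $G$ satisfies $\operatorname{tww}(G) \leq \alpha + \max\{\gamma, \beta\}$.
   Context: All graphs are finite, simple and undirected. The sets of the partition are allowed to be empty. A vertex $v$ (possibly in $S$) is mixed on a vertex-set $S$ if $v$ has both a neighbour in $S$ and a non-neighbour in $S$, where the non-neighbour may be $v$ itself. Twin-width: a trigraph is a graph together with a partition of its edge-set into black edges and red edges; an ordinary graph is regarded as a trigraph with all edges black. Contracting two distinct (not necessarily adjacent) vertices $u,v$ of a trigraph means replacing them by a single new vertex $w$ such that, for every other vertex $x$: $wx$ is a black edge if both $ux$ and $vx$ are black edges; $wx$ is a non-edge if neither $ux$ nor $vx$ is an edge; and $wx$ is a red edge otherwise. All other edges and their colours are unchanged. The red degree of a vertex is the number of red edges incident with it. A contraction sequence of an $n$-vertex graph $G$ is a sequence of trigraphs $G = G_n, \dots, G_1 = K_1$ where each $G_s$ is obtained from $G_{s+1}$ by one contraction; it is a $d$-sequence if every trigraph in it has maximum red degree at most $d$. The twin-width $\operatorname{tww}(G)$ is the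 minimum integer $d$ such that $G$ has a $d$-sequence. *)

theory Defs
  imports Complex_Main "HOL-Library.Disjoint_Sets"
begin

definition simple_graph :: "'a set \<Rightarrow> 'a set set \<Rightarrow> bool" where
  "simple_graph V E \<longleftrightarrow> finite V \<and> (\<forall>e\<in>E. e \<subseteq> V \<and> card e = 2)"

text \<open>
  If \<open>v \<in> S\<close>, then \<open>v\<close> itself may serve as the non-neighbour \<open>y\<close>, since \<open>{v, v}\<close> is never an
  edge of a simple graph.
\<close>

definition mixed_on :: "'a set set \<Rightarrow> 'a \<Rightarrow> 'a set \<Rightarrow> bool" where
  "mixed_on E v S \<longleftrightarrow> (\<exists>x\<in>S. {v, x} \<in> E) \<and> (\<exists>y\<in>S. {v, y} \<notin> E)"

record 'a trigraph =
  tverts :: "'a set"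
  black_edges :: "'a set set"
  red_edges :: "'a set set"

definition tedges :: "'a trigraph \<Rightarrow> 'a set set" where
  "tedges T = black_edges T \<union> red_edges T"

definition is_trigraph :: "'a trigraph \<Rightarrow> bool" where
  "is_trigraph T \<longleftrightarrow> simple_graph (tverts T) (tedges T) \<and> black_edges T \<inter> red_edges T = {}"

definition trigraph_of :: "'a set \<Rightarrow> 'a set set \<Rightarrow> 'a trigraph" where
  "trigraph_of V E = \<lparr>tverts = V, black_edges = E, red_edges = {}\<rparr>"

definition contract :: "'a \<Rightarrow> 'a \<Rightarrow> 'a \<Rightarrow> 'a trigraph \<Rightarrow> 'a trigraph" where
  "contract u v w T =
     (let R = tverts T - {u, v};
          B = {x \<in> R. {u, x} \<in> black_edges T \<and> {v, x} \<in> black_edges T};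
          N = {x \<in> R. {u, x} \<notin> tedges T \<and> {v, x} \<notin> tedges T}
      in \<lparr>tverts = insert w R,
          black_edges = {e \<in> black_edges T. e \<subseteq> R} \<union> {{w, x} |x. x \<in> B},
          red_edges = {e \<in> red_edges T. e \<subseteq> R} \<union> {{w, x} |x. x \<in> R - B - N}\<rparr>)"

text \<open>
  All trigraphs in a contraction sequence live on the same type, which may be finite.  The name
  \<open>w\<close> of the new vertex therefore only has to differ from the vertices that survive; it may reuse
  \<open>u\<close> or \<open>v\<close>.  This does not affect the trigraph obtained, up to isomorphism.
\<close>

definition is_contraction :: "'a trigraph \<Rightarrow> 'a trigraph \<Rightarrow> bool" where
  "is_contraction T T' \<longleftrightarrow>
     (\<exists>u v w. u \<in> tverts T \<and> v \<in> tverts T \<and> u \<noteq> v \<and> w \<notin> tverts T - {u, v} \<and>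
        T' = contract u v w T)"

definition red_degree :: "'a trigraph \<Rightarrow> 'a \<Rightarrow> nat" where
  "red_degree T x = card {e \<in> red_edges T. x \<in> e}"

text \<open>Only the values \<open>S n, \<dots>, S 1\<close> matter, where \<open>n\<close> is the number of vertices.\<close>

definition contraction_sequence :: "'a set \<Rightarrow> 'a set set \<Rightarrow> (nat \<Rightarrow> 'a trigraph) \<Rightarrow> bool" where
  "contraction_sequence V E S \<longleftrightarrow>
     card V \<ge> 1 \<and>
     S (card V) = trigraph_of V E \<and>
     (\<forall>s\<in>{1..<card V}. is_contraction (S (Suc s)) (S s)) \<and>
     (\<exists>x. S 1 = trigraph_of {x} {})"

definition d_sequence :: "nat \<Rightarrow> 'a set \<Rightarrow> 'a set set \<Rightarrow> (nat \<Rightarrow> 'a trigraph) \<Rightarrow> bool" where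
  "d_sequence d V E S \<longleftrightarrow>
     contraction_sequence V E S \<and>
     (\<forall>s\<in>{1..card V}. \<forall>x\<in>tverts (S s). red_degree (S s) x \<le> d)"

text \<open>
  The graph without vertices has no contraction sequence; by convention its twin-width is \<open>0\<close>.
  Every other finite simple graph has a \<open>d\<close>-sequence for some \<open>d\<close> (lemma \<open>ex_d_sequence\<close>), so that
  the minimum below is attained.
\<close>

definition tww :: "'a set \<Rightarrow> 'a set set \<Rightarrow> nat" where
  "tww V E = (if V = {} then 0 else (LEAST d. \<exists>S. d_sequence d V E S))"

lemma is_trigraph_trigraph_of: "simple_graph V E \<Longrightarrow> is_trigraph (trigraph_of V E)"
  by (simp add: is_trigraph_def trigraph_of_def tedges_def)

lemma is_trigraph_contraction:
  assumes T: "is_trigraph T" and "is_contraction T T'"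
  shows "is_trigraph T'" and "card (tverts T) = Suc (card (tverts T'))"
proof -
  obtain u v w where uv: "u \<in> tverts T" "v \<in> tverts T" "u \<noteq> v" "w \<notin> tverts T - {u, v}"
    and T': "T' = contract u v w T"
    using assms(2) unfolding is_contraction_def by blast
  have fin: "finite (tverts T)"
    using T by (simp add: is_trigraph_def simple_graph_def)
  have edge: "e \<subseteq> tverts T" "card e = 2" if "e \<in> black_edges T \<or> e \<in> red_edges T" for e
    using T that by (auto simp: is_trigraph_def simple_graph_def tedges_def)
  have disj: "black_edges T \<inter> red_edges T = {}"
    using T by (simp add: is_trigraph_def)
  have two: "card {w, x} = 2" if "x \<in> tverts T" "x \<noteq> u" "x \<noteq> v" for x
  proof -
    have "w \<noteq> x" using that uv(4) by blast
    then show ?thesis by simp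
  qed
  have "simple_graph (tverts T') (tedges T')"
    unfolding simple_graph_def tedges_def T' contract_def Let_def
    using fin edge two by auto
  moreover have "black_edges T' \<inter> red_edges T' = {}"
    using disj uv(4) unfolding T' contract_def Let_def
    by (auto simp: doubleton_eq_iff)
  ultimately show "is_trigraph T'"
    by (simp add: is_trigraph_def)
  have "card (tverts T) = Suc (Suc (card (tverts T - {u, v})))"
  proof -
    have "tverts T = insert u (insert v (tverts T - {u, v}))" using uv by blast
    then have "card (tverts T) = card (insert u (insert v (tverts T - {u, v})))" by simp
    also have "\<dots> = Suc (Suc (card (tverts T - {u, v})))"
      using fin uv(3) by (subst card_insert_disjoint; simp)+
    finally show ?thesis .
  qed
  then show "card (tverts T) = Suc (card (tverts T'))"
    using fin uv(4) unfolding T' contract_def Let_def by simp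
qed

lemma ex_contractions:
  assumes "is_trigraph T" "card (tverts T) = Suc n"
  shows "\<exists>S. S (Suc n) = T \<and> (\<forall>s\<in>{1..<Suc n}. is_contraction (S (Suc s)) (S s)) \<and>
    (\<exists>x. S 1 = trigraph_of {x} {})"
  using assms
proof (induction n arbitrary: T)
  case 0
  then obtain x where x: "tverts T = {x}"
    using card_1_singletonE by (metis One_nat_def)
  have "e \<notin> tedges T" for e
  proof
    assume "e \<in> tedges T"
    then have "e \<subseteq> {x}" "card e = 2"
      using 0 x by (auto simp: is_trigraph_def simple_graph_def)
    then show False
      using card_mono[of "{x}" e] by simp
  qed
  then have "T = trigraph_of {x} {}"
    using x by (cases T) (auto simp: trigraph_of_def tedges_def)
  then show ?case by (intro exI[of _ "\<lambda>_. T"]) auto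
next
  case (Suc n)
  obtain u where u: "u \<in> tverts T"
    using Suc.prems(2) by (metis card.empty equals0I nat.distinct(1))
  obtain v where v: "v \<in> tverts T" "v \<noteq> u"
    using Suc.prems(2) u
    by (metis One_nat_def card_1_singleton_iff is_singletonI' is_singleton_def empty_iff
        nat.inject nat.distinct(1))
  define T' where "T' = contract u v u T"
  have c: "is_contraction T T'"
    unfolding is_contraction_def T'_def using u v by blast
  have "is_trigraph T'" "card (tverts T') = Suc n"
    using is_trigraph_contraction[OF Suc.prems(1) c] Suc.prems(2) by auto
  from Suc.IH[OF this] obtain S where
    S: "S (Suc n) = T'" "\<forall>s\<in>{1..<Suc n}. is_contraction (S (Suc s)) (S s)"
      "\<exists>x. S 1 = trigraph_of {x} {}"
    by blast
  show ?case
    using S c by (intro exI[of _ "S(Suc (Suc n) := T)"]) (auto simp: less_Suc_eq)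
qed

lemma ex_d_sequence:
  assumes "simple_graph V E" "V \<noteq> {}"
  shows "\<exists>d S. d_sequence d V E S"
proof -
  have fin: "finite V" using assms(1) by (simp add: simple_graph_def)
  then obtain n where n: "card V = Suc n"
    using assms(2) by (metis card_0_eq not0_implies_Suc)
  have "is_trigraph (trigraph_of V E)" "card (tverts (trigraph_of V E)) = Suc n"
    using is_trigraph_trigraph_of[OF assms(1)] n by (simp_all add: trigraph_of_def)
  from ex_contractions[OF this] obtain S where S: "contraction_sequence V E S"
    unfolding contraction_sequence_def n by auto
  have tri: "is_trigraph (S s)" if "1 \<le> s" "s \<le> card V" for s
    using that(2,1)
  proof (induction rule: inc_induct)
    case base
    then show ?case
      using S is_trigraph_trigraph_of[OF assms(1)] by (simp add: contraction_sequence_def)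
  next
    case (step s)
    then show ?case
      using S is_trigraph_contraction(1) by (force simp: contraction_sequence_def)
  qed
  define D where "D = (\<Union>s\<in>{1..card V}. red_degree (S s) ` tverts (S s))"
  have "finite D"
    unfolding D_def using tri by (auto simp: is_trigraph_def simple_graph_def)
  then have "\<forall>k\<in>D. k \<le> Max D" by simp
  then have "d_sequence (Max D) V E S"
    unfolding d_sequence_def using S by (auto simp: D_def)
  then show ?thesis by blast
qed

end

theory Submission imports Defs begin

text \<open>
  Contract \<open>X 1\<close> to a single vertex, adding one vertex of \<open>X 1\<close> at a time, then do the same with
  \<open>X 2\<close>, and so on up to \<open>X t\<close>. At any moment at most \<open>t\<close> parts have been contracted. Two vertices
  that are still untouched are never joined by a red edge, and an untouched vertex joined by a red
  edge to a part contained in \<open>X j\<close> is mixed on \<open>X j\<close>, hence lies in \<open>Y j\<close>. So all red degrees are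
  at most \<open>t + \<gamma>\<close>. Afterwards at most \<open>t + \<beta>\<close> vertices are left, and any further contractions will do.
\<close>

section \<open>Trigraphs as quotients of the graph by a map\<close>

definition fibres_complete :: "'a set \<Rightarrow> 'a set set \<Rightarrow> ('a \<Rightarrow> 'a) \<Rightarrow> 'a \<Rightarrow> 'a \<Rightarrow> bool" where
  "fibres_complete V E f a b \<longleftrightarrow> (\<forall>x\<in>V. \<forall>y\<in>V. f x = a \<longrightarrow> f y = b \<longrightarrow> {x, y} \<in> E)"

definition fibres_anticomplete :: "'a set \<Rightarrow> 'a set set \<Rightarrow> ('a \<Rightarrow> 'a) \<Rightarrow> 'a \<Rightarrow> 'a \<Rightarrow> bool" where
  "fibres_anticomplete V E f a b \<longleftrightarrow> (\<forall>x\<in>V. \<forall>y\<in>V. f x = a \<longrightarrow> f y = b \<longrightarrow> {x, y} \<notin> E)"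

text \<open>A part of the contracted graph is a fibre of \<open>f\<close> on \<open>V\<close>, named by the value of \<open>f\<close> on it.\<close>

definition quotient_trigraph :: "'a set \<Rightarrow> 'a set set \<Rightarrow> ('a \<Rightarrow> 'a) \<Rightarrow> 'a trigraph" where
  "quotient_trigraph V E f =
     \<lparr>tverts = f ` V,
      black_edges = {{a, b} |a b. a \<in> f ` V \<and> b \<in> f ` V \<and> a \<noteq> b \<and> fibres_complete V E f a b},
      red_edges = {{a, b} |a b. a \<in> f ` V \<and> b \<in> f ` V \<and> a \<noteq> b \<and>
        \<not> fibres_complete V E f a b \<and> \<not> fibres_anticomplete V E f a b}\<rparr>"

text \<open>The merged fibre keeps the name \<open>u\<close>, which matches
  \<open>contract u v u\<close>. No fresh vertex name is ever required, so the argument also works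
  over a finite type.\<close>

definition merge :: "'a \<Rightarrow> 'a \<Rightarrow> ('b \<Rightarrow> 'a) \<Rightarrow> 'b \<Rightarrow> 'a" where
  "merge u v f x = (if f x = v then u else f x)"

lemma fibres_complete_commute: "fibres_complete V E f a b \<longleftrightarrow> fibres_complete V E f b a"
proof -
  have "fibres_complete V E f b a" if "fibres_complete V E f a b" for a b
    using that unfolding fibres_complete_def
    by (intro ballI impI, subst insert_commute, blast)
  then show ?thesis by blast
qed

lemma fibres_anticomplete_commute:
  "fibres_anticomplete V E f a b \<longleftrightarrow> fibres_anticomplete V E f b a"
proof -
  have "fibres_anticomplete V E f b a" if "fibres_anticomplete V E f a b" for a b
    using that unfolding fibres_anticomplete_def
    by (intro ballI impI, subst insert_commute, blast)
  then show ?thesis by blast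
qed

text \<open>Both fibres are nonempty, so some pair between them decides. For a value outside the
  image both properties would hold vacuously.\<close>

lemma not_complete_and_anticomplete:
  assumes "a \<in> f ` V" "b \<in> f ` V" "fibres_complete V E f a b"
  shows "\<not> fibres_anticomplete V E f a b"
  using assms unfolding fibres_complete_def fibres_anticomplete_def by blast

lemma tverts_quotient [simp]: "tverts (quotient_trigraph V E f) = f ` V"
  by (simp add: quotient_trigraph_def)

lemma black_edge_quotient_iff:
  "{a, b} \<in> black_edges (quotient_trigraph V E f) \<longleftrightarrow>
     a \<in> f ` V \<and> b \<in> f ` V \<and> a \<noteq> b \<and> fibres_complete V E f a b"
  unfolding quotient_trigraph_def
  using fibres_complete_commute[of V E f] by (auto simp: doubleton_eq_iff)

lemma red_edge_quotient_iff:
  "{a, b} \<in> red_edges (quotient_trigraph V E f) \<longleftrightarrow>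
     a \<in> f ` V \<and> b \<in> f ` V \<and> a \<noteq> b \<and>
     \<not> fibres_complete V E f a b \<and> \<not> fibres_anticomplete V E f a b"
  unfolding quotient_trigraph_def
  using fibres_complete_commute[of V E f] fibres_anticomplete_commute[of V E f]
  by (auto simp: doubleton_eq_iff)

lemma tedge_quotient_iff:
  "{a, b} \<in> tedges (quotient_trigraph V E f) \<longleftrightarrow>
     a \<in> f ` V \<and> b \<in> f ` V \<and> a \<noteq> b \<and> \<not> fibres_anticomplete V E f a b"
  unfolding tedges_def Un_iff black_edge_quotient_iff red_edge_quotient_iff
  using not_complete_and_anticomplete[of a f V b E] by blast

lemma merge_image:
  assumes "u \<in> f ` V" "v \<in> f ` V" "u \<noteq> v"
  shows "merge u v f ` V = insert u (f ` V - {u, v})"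
  using assms by (force simp: merge_def image_iff)

lemma card_merge_image:
  assumes "finite V" "u \<in> f ` V" "v \<in> f ` V" "u \<noteq> v"
  shows "card (f ` V) = Suc (card (merge u v f ` V))"
proof -
  have "f ` V = insert v (merge u v f ` V)" "v \<notin> merge u v f ` V"
    using assms by (auto simp: merge_image)
  then show ?thesis
    using assms(1) by (metis card_insert_disjoint finite_imageI)
qed

text \<open>After merging, the fibre over \<open>u\<close> is the union of the old fibres over
  \<open>u\<close> and \<open>v\<close>, while all other fibres are unchanged.\<close>

lemma fibres_complete_merge:
  assumes "u \<noteq> v" "a \<noteq> u" "a \<noteq> v"
  shows "fibres_complete V E (merge u v f) u a \<longleftrightarrow>
      fibres_complete V E f u a \<and> fibres_complete V E f v a"
    and "b \<noteq> u \<Longrightarrow> b \<noteq> v \<Longrightarrow>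
      fibres_complete V E (merge u v f) a b \<longleftrightarrow> fibres_complete V E f a b"
  using assms unfolding fibres_complete_def merge_def by (auto split: if_splits)

lemma fibres_anticomplete_merge:
  assumes "u \<noteq> v" "a \<noteq> u" "a \<noteq> v"
  shows "fibres_anticomplete V E (merge u v f) u a \<longleftrightarrow>
      fibres_anticomplete V E f u a \<and> fibres_anticomplete V E f v a"
    and "b \<noteq> u \<Longrightarrow> b \<noteq> v \<Longrightarrow>
      fibres_anticomplete V E (merge u v f) a b \<longleftrightarrow> fibres_anticomplete V E f a b"
  using assms unfolding fibres_anticomplete_def merge_def by (auto split: if_splits)

text \<open>Reduces equality of edge sets to membership of pairs \<open>{a, b}\<close>, the form in
  which the edge characterisations of quotients are stated.\<close>

lemma doubleton_sets_eqI:
  assumes "\<And>e. e \<in> A \<Longrightarrow> \<exists>a b. e = {a, b}" "\<And>e. e \<in> B \<Longrightarrow> \<exists>a b. e = {a, b}"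
    and "\<And>a b. {a, b} \<in> A \<longleftrightarrow> {a, b} \<in> B"
  shows "A = B"
  using assms by (metis subsetI subset_antisym)

text \<open>A union of two fibres is complete to a third fibre iff both of them are, and likewise
  for anticomplete. These are exactly the rules for black edges and non-edges under contraction, and
  red is what remains in both descriptions.\<close>

lemma contract_quotient:
  assumes uv: "u \<in> f ` V" "v \<in> f ` V" "u \<noteq> v"
  shows "contract u v u (quotient_trigraph V E f) = quotient_trigraph V E (merge u v f)"
    (is "?C = ?Q")
proof -
  let ?T = "quotient_trigraph V E f"
  let ?R = "f ` V - {u, v}"
  have black: "black_edges ?C = {e \<in> black_edges ?T. e \<subseteq> ?R} \<union>
      {{u, x} |x. x \<in> ?R \<and> {u, x} \<in> black_edges ?T \<and> {v, x} \<in> black_edges ?T}"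
    unfolding contract_def Let_def by auto
  have red: "red_edges ?C = {e \<in> red_edges ?T. e \<subseteq> ?R} \<union>
      {{u, x} |x. x \<in> ?R \<and> \<not> ({u, x} \<in> black_edges ?T \<and> {v, x} \<in> black_edges ?T) \<and>
        \<not> ({u, x} \<notin> tedges ?T \<and> {v, x} \<notin> tedges ?T)}"
    unfolding contract_def Let_def by auto
  have "black_edges ?C = black_edges ?Q"
  proof (rule doubleton_sets_eqI)
    show "\<exists>a b. e = {a, b}" if "e \<in> black_edges ?C" for e
      using that unfolding black by (auto simp: quotient_trigraph_def)
    show "\<exists>a b. e = {a, b}" if "e \<in> black_edges ?Q" for e
      using that by (auto simp: quotient_trigraph_def)
    show "{a, b} \<in> black_edges ?C \<longleftrightarrow> {a, b} \<in> black_edges ?Q" for a b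
      unfolding black black_edge_quotient_iff merge_image[OF uv] Un_iff mem_Collect_eq
      \<comment> \<open>The merge rules have \<open>u\<close> in first position; the case
        \<open>b = u\<close> is brought to this form by symmetry.\<close>
      using fibres_complete_merge[OF uv(3)] uv fibres_complete_commute[of V E "merge u v f" a u]
      by (cases "a = u"; cases "b = u") (auto simp: doubleton_eq_iff)
  qed
  moreover have "red_edges ?C = red_edges ?Q"
  proof (rule doubleton_sets_eqI)
    show "\<exists>a b. e = {a, b}" if "e \<in> red_edges ?C" for e
      using that unfolding red by (auto simp: quotient_trigraph_def)
    show "\<exists>a b. e = {a, b}" if "e \<in> red_edges ?Q" for e
      using that by (auto simp: quotient_trigraph_def)
    show "{a, b} \<in> red_edges ?C \<longleftrightarrow> {a, b} \<in> red_edges ?Q" for a b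
      unfolding red red_edge_quotient_iff black_edge_quotient_iff tedge_quotient_iff
        merge_image[OF uv] Un_iff mem_Collect_eq
      using fibres_complete_merge[OF uv(3)] fibres_anticomplete_merge[OF uv(3)] uv
        fibres_complete_commute[of V E "merge u v f" a u]
        fibres_anticomplete_commute[of V E "merge u v f" a u]
      by (cases "a = u"; cases "b = u") (auto simp: doubleton_eq_iff)
  qed
  moreover have "tverts ?C = tverts ?Q"
    by (simp add: contract_def Let_def merge_image[OF uv])
  ultimately show ?thesis by (cases ?C; cases ?Q) simp
qed

text \<open>Singleton fibres are always complete or anticomplete to each other, so no red edge
  arises.\<close>

lemma quotient_id:
  assumes "simple_graph V E"
  shows "quotient_trigraph V E (\<lambda>x. x) = trigraph_of V E"
proof -
  have E: "e \<subseteq> V \<and> (\<exists>a b. e = {a, b} \<and> a \<noteq> b)" if "e \<in> E" for e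
    using assms that unfolding simple_graph_def card_2_iff by metis
  have "{{a, b} |a b. a \<in> V \<and> b \<in> V \<and> a \<noteq> b \<and> fibres_complete V E (\<lambda>x. x) a b} = E"
    unfolding fibres_complete_def using E by fastforce
  then show ?thesis
    unfolding quotient_trigraph_def trigraph_of_def
    by (auto simp: fibres_complete_def fibres_anticomplete_def)
qed

lemma quotient_single:
  assumes "f ` V = {x}"
  shows "quotient_trigraph V E f = trigraph_of {x} {}"
  using assms unfolding quotient_trigraph_def trigraph_of_def by auto

section \<open>Contraction sequences from an invariant on maps\<close>

lemma red_degree_quotient_le:
  assumes "{b. {a, b} \<in> red_edges (quotient_trigraph V E f)} \<subseteq> B" "finite B"
  shows "red_degree (quotient_trigraph V E f) a \<le> card B"
proof -
  have "\<exists>b. e = {a, b}" if "e \<in> red_edges (quotient_trigraph V E f)" "a \<in> e" for e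
    using that by (fastforce simp: quotient_trigraph_def)
  then have "{e \<in> red_edges (quotient_trigraph V E f). a \<in> e} \<subseteq> (\<lambda>b. {a, b}) ` B"
    using assms(1) by fastforce
  then show ?thesis
    unfolding red_degree_def using assms(2)
    by (meson card_image_le card_mono finite_imageI order_trans)
qed

text \<open>Induction on the number of fibres, which drops by one with each merge. The invariant
  \<open>P\<close> supplies the next merge through \<open>step\<close> and the red degree bound
  through \<open>deg\<close>.\<close>

lemma ex_quotient_sequence:
  assumes fin: "finite V"
    and step: "\<And>f. \<lbrakk>P f; card (f ` V) \<ge> 2\<rbrakk> \<Longrightarrow>
      \<exists>u\<in>f ` V. \<exists>v\<in>f ` V. u \<noteq> v \<and> P (merge u v f)"
    and deg: "\<And>f a. \<lbrakk>P f; a \<in> f ` V\<rbrakk> \<Longrightarrow> red_degree (quotient_trigraph V E f) a \<le> d"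
    and "P f" "card (f ` V) = Suc n"
  shows "\<exists>S. S (Suc n) = quotient_trigraph V E f \<and>
    (\<forall>s\<in>{1..<Suc n}. is_contraction (S (Suc s)) (S s)) \<and> (\<exists>x. S 1 = trigraph_of {x} {}) \<and>
    (\<forall>s\<in>{1..Suc n}. \<forall>x\<in>tverts (S s). red_degree (S s) x \<le> d)"
  using assms(4,5)
proof (induction n arbitrary: f)
  case 0
  then obtain x where x: "f ` V = {x}"
    by (metis One_nat_def card_1_singletonE)
  have "\<forall>a\<in>tverts (quotient_trigraph V E f). red_degree (quotient_trigraph V E f) a \<le> d"
    using deg[OF 0(1)] by simp
  then show ?case
    using quotient_single[OF x, of E] by (intro exI[of _ "\<lambda>_. quotient_trigraph V E f"])(simp, blast)
next
  case (Suc n)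
  obtain u v where uv: "u \<in> f ` V" "v \<in> f ` V" "u \<noteq> v" and P: "P (merge u v f)"
    using step[OF Suc.prems(1)] Suc.prems(2) by fastforce
  have "card (merge u v f ` V) = Suc n"
    using card_merge_image[OF fin uv] Suc.prems(2) by simp
  from Suc.IH[OF P this] obtain S where
    S: "S (Suc n) = quotient_trigraph V E (merge u v f)"
      "\<forall>s\<in>{1..<Suc n}. is_contraction (S (Suc s)) (S s)" "\<exists>x. S 1 = trigraph_of {x} {}"
      "\<forall>s\<in>{1..Suc n}. \<forall>x\<in>tverts (S s). red_degree (S s) x \<le> d"
    by blast
  have "is_contraction (quotient_trigraph V E f) (quotient_trigraph V E (merge u v f))"
    unfolding is_contraction_def contract_quotient[OF uv, symmetric] using uv by auto
  \<comment> \<open>Indices count vertices, so the trigraph before the merge is put on top of the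
    sequence obtained for the merged map.\<close>
  then show ?case
    using S deg[OF Suc.prems(1)]
    by (intro exI[of _ "S(Suc (Suc n) := quotient_trigraph V E f)"])
      (auto simp: less_Suc_eq le_Suc_eq)
qed

lemma tww_le_if_merges:
  assumes G: "simple_graph V E"
    and step: "\<And>f. \<lbrakk>P f; card (f ` V) \<ge> 2\<rbrakk> \<Longrightarrow>
      \<exists>u\<in>f ` V. \<exists>v\<in>f ` V. u \<noteq> v \<and> P (merge u v f)"
    and deg: "\<And>f a. \<lbrakk>P f; a \<in> f ` V\<rbrakk> \<Longrightarrow> red_degree (quotient_trigraph V E f) a \<le> d"
    and "P (\<lambda>x. x)"
  shows "tww V E \<le> d"
proof (cases "V = {}")
  case False
  have fin: "finite V" using G by (simp add: simple_graph_def)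
  then obtain n where n: "card V = Suc n"
    using False by (metis card_0_eq not0_implies_Suc)
  then have "card ((\<lambda>x. x) ` V) = Suc n" by simp
  from ex_quotient_sequence[where P = P, OF fin step deg assms(4) this]
  have "\<exists>S. d_sequence d V E S"
    unfolding d_sequence_def contraction_sequence_def n quotient_id[OF G] by auto
  then show ?thesis
    using False by (simp add: tww_def Least_le)
qed (simp add: tww_def)

lemma card_image_const:
  assumes "\<And>x y. \<lbrakk>x \<in> A; y \<in> A\<rbrakk> \<Longrightarrow> f x = f y"
  shows "finite (f ` A) \<and> card (f ` A) \<le> 1"
proof (cases "A = {}")
  case False
  then obtain x where "x \<in> A" by blast
  then have "f ` A = {f x}" using assms by blast
  then show ?thesis by simp
qed simp

section \<open>Contracting the parts in order: red degrees\<close>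

locale partitioned_graph =
  fixes V :: "'a set" and E :: "'a set set" and t g :: nat and X :: "nat \<Rightarrow> 'a set"
  assumes graph: "simple_graph V E"
    and disj: "disjoint_family_on X {1..t+1}"
    and cover: "(\<Union>i\<in>{1..t+1}. X i) = V"
    and mixed: "\<And>i. i \<in> {1..t} \<Longrightarrow>
      card {v \<in> (\<Union>j\<in>{i..t+1}. X j). mixed_on E v (X i)} \<le> g"
begin

text \<open>
  \<open>X 1, \<dots>, X (i - 1)\<close> have been contracted completely, and \<open>A\<close> is the part of \<open>X i\<close> that has been
  contracted so far.
\<close>

definition phase :: "('a \<Rightarrow> 'a) \<Rightarrow> nat \<Rightarrow> 'a set \<Rightarrow> bool" where
  "phase f i A \<longleftrightarrow> i \<in> {1..t} \<and> A \<subseteq> X i \<and>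
     (\<forall>x\<in>V. \<forall>y\<in>V. f x = f y \<longleftrightarrow>
        x = y \<or> (\<exists>j\<in>{1..<i}. x \<in> X j \<and> y \<in> X j) \<or> (x \<in> A \<and> y \<in> A))"

lemma finite_V: "finite V"
  using graph by (simp add: simple_graph_def)

lemma part_subset: "i \<in> {1..t+1} \<Longrightarrow> X i \<subseteq> V"
  using cover by blast

lemma part_unique: "\<lbrakk>x \<in> X i; x \<in> X j; i \<in> {1..t+1}; j \<in> {1..t+1}\<rbrakk> \<Longrightarrow> i = j"
  using disj unfolding disjoint_family_on_def by blast

lemma phaseD:
  assumes "phase f i A"
  shows "i \<in> {1..t}" "A \<subseteq> X i" "A \<subseteq> V"
    "\<lbrakk>x \<in> V; y \<in> V\<rbrakk> \<Longrightarrow> f x = f y \<longleftrightarrow>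
        x = y \<or> (\<exists>j\<in>{1..<i}. x \<in> X j \<and> y \<in> X j) \<or> (x \<in> A \<and> y \<in> A)"
proof -
  show i: "i \<in> {1..t}" and A: "A \<subseteq> X i"
    using assms unfolding phase_def by blast+
  show "A \<subseteq> V" using A part_subset[of i] i by auto
  show "\<lbrakk>x \<in> V; y \<in> V\<rbrakk> \<Longrightarrow> f x = f y \<longleftrightarrow>
        x = y \<or> (\<exists>j\<in>{1..<i}. x \<in> X j \<and> y \<in> X j) \<or> (x \<in> A \<and> y \<in> A)"
    using assms unfolding phase_def by blast
qed

text \<open>Contracted fibres contribute at most \<open>t\<close> red neighbours to any vertex. An
  untouched red neighbour of a fibre inside \<open>X j\<close> is mixed on that fibre, hence on the
  larger set \<open>X j\<close>, so there are at most \<open>g\<close> of these.\<close>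

lemma phase_red_degree:
  assumes ph: "phase f i A" and a: "a \<in> f ` V"
  shows "red_degree (quotient_trigraph V E f) a \<le> t + g"
proof -
  note p = phaseD[OF ph]
  \<comment> \<open>\<open>?W\<close> collects the touched vertices and \<open>?C\<close> the names
    of their fibres.\<close>
  let ?W = "(\<Union>j\<in>{1..<i}. X j) \<union> A"
  let ?C = "(\<Union>j\<in>{1..<i}. f ` X j) \<union> f ` A"
  have sub: "X j \<subseteq> V" if "j \<in> {1..<i}" for j
    using that p(1) by (intro part_subset) auto
  have "card (\<Union>j\<in>{1..<i}. f ` X j) \<le> (\<Sum>j\<in>{1..<i}. card (f ` X j))"
    by (intro card_UN_le) simp
  also have "\<dots> \<le> (\<Sum>j\<in>{1..<i}. 1)"
  proof (intro sum_mono)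
    fix j assume j: "j \<in> {1..<i}"
    then show "card (f ` X j) \<le> 1"
      using card_image_const[of "X j" f] p(4) sub by blast
  qed
  finally have "card (\<Union>j\<in>{1..<i}. f ` X j) \<le> i - 1" by simp
  moreover have "card (f ` A) \<le> 1"
    using card_image_const[of A f] p(3,4) by blast
  \<comment> \<open>One name for each of the \<open>i - 1\<close> finished parts and one for
    \<open>A\<close>; the sum is \<open>i\<close>, as \<open>i\<close> is at least 1.\<close>
  ultimately have "card ?C \<le> (i - 1) + 1"
    by (meson add_mono card_Un_le order_trans)
  then have cardC: "card ?C \<le> t" using p(1) by auto
  have C: "?C = f ` ?W" by (simp add: image_Un image_UN)
  have finC: "finite ?C"
    unfolding C using sub p(3) finite_V by (meson UN_least Un_least finite_imageI finite_subset)
  have trivial: "y = x" if "x \<in> V" "x \<notin> ?W" "y \<in> V" "f y = f x" for x y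
    using p(4)[of y x] that by blast
  show ?thesis
  proof (cases "a \<in> ?C")
    case False
    then obtain x where x: "x \<in> V" "x \<notin> ?W" "a = f x" using a by blast
    have "b \<in> ?C" if red: "{a, b} \<in> red_edges (quotient_trigraph V E f)" for b
    proof (rule ccontr)
      assume b: "b \<notin> ?C"
      have "b \<in> f ` V" using red unfolding red_edge_quotient_iff by blast
      then obtain y where y: "y \<in> V" "y \<notin> ?W" "b = f y" using b by blast
      \<comment> \<open>Both fibres are singletons, and a single pair cannot be
        heterogeneous.\<close>
      have "fibres_complete V E f a b \<or> fibres_anticomplete V E f a b"
        using trivial x y unfolding fibres_complete_def fibres_anticomplete_def by metis
      then show False using red unfolding red_edge_quotient_iff by blast
    qed
    then have "red_degree (quotient_trigraph V E f) a \<le> card ?C"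
      by (intro red_degree_quotient_le finC) blast
    then show ?thesis using cardC by simp
  next
    case True
    then obtain x j where x: "x \<in> V" "a = f x" "x \<in> X j" "j \<in> {1..i}"
    proof (elim UnE UN_E imageE)
      fix k x assume "k \<in> {1..<i}" "a = f x" "x \<in> X k"
      then show thesis using that[of x k] sub by auto
    next
      fix x assume "a = f x" "x \<in> A"
      then show thesis using that[of x i] p(1,2,3) by auto
    qed
    have j: "j \<in> {1..t}" using x(4) p(1) by auto
    have fib: "z \<in> X j" if z: "z \<in> V" "f z = a" for z
    proof -
      from p(4)[OF z(1) x(1)] z(2) x(2)
      consider "z = x" | k where "k \<in> {1..<i}" "z \<in> X k" "x \<in> X k" | "z \<in> A" "x \<in> A" by blast
      then show ?thesis
      proof cases
        case 2
        then have "k = j" using part_unique[OF 2(3) x(3)] j p(1) by auto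
        then show ?thesis using 2 by simp
      next
        case 3
        then have "i = j" using part_unique[of x i j] p(1,2) x(3) j by auto
        then show ?thesis using 3 p(2) by blast
      qed (use x in simp)
    qed
    let ?Y = "{v \<in> (\<Union>k\<in>{j..t+1}. X k). mixed_on E v (X j)}"
    have finY: "finite ?Y"
      by (rule finite_subset[OF _ finite_V]) (use cover j in auto)
    have "b \<in> ?C \<union> f ` ?Y" if red: "{a, b} \<in> red_edges (quotient_trigraph V E f)" for b
    proof (cases "b \<in> ?C")
      case False
      have "b \<in> f ` V" using red unfolding red_edge_quotient_iff by blast
      then obtain y where y: "y \<in> V" "y \<notin> ?W" "b = f y" using False by blast
      have "\<not> fibres_complete V E f b a" "\<not> fibres_anticomplete V E f b a"
        using red unfolding red_edge_quotient_iff
        by (metis fibres_complete_commute, metis fibres_anticomplete_commute)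
      \<comment> \<open>The fibre of \<open>b\<close> is \<open>{y}\<close>. Failure of completeness
        gives a non-neighbour of \<open>y\<close> in the fibre of \<open>a\<close>, failure of
        anticompleteness a neighbour, and by \<open>fib\<close> both lie in
        \<open>X j\<close>.\<close>
      then have "mixed_on E y (X j)"
        unfolding mixed_on_def fibres_complete_def fibres_anticomplete_def
        using fib trivial y by metis
      moreover obtain k where k: "k \<in> {1..t+1}" "y \<in> X k" using y(1) cover by blast
      \<comment> \<open>An index below \<open>i\<close> would put \<open>y\<close> into
        \<open>?W\<close>. Since \<open>j \<le> i\<close>, the vertex \<open>y\<close> lies in the
        union over which \<open>?Y\<close> ranges.\<close>
      moreover have "i \<le> k" using y(2) k by force
      ultimately show ?thesis using y x(4) by fastforce
    qed simp
    then have "red_degree (quotient_trigraph V E f) a \<le> card (?C \<union> f ` ?Y)"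
      by (intro red_degree_quotient_le finite_UnI finC finite_imageI finY) blast
    also have "\<dots> \<le> card ?C + card ?Y"
      by (rule order_trans[OF card_Un_le add_left_mono[OF card_image_le[OF finY]]])
    also have "\<dots> \<le> t + g"
      using cardC mixed[OF j] by simp
    finally show ?thesis .
  qed
qed

section \<open>Choosing the next merge\<close>

lemma card_image_if_const:
  assumes "\<And>j x y. \<lbrakk>j \<in> {1..t}; x \<in> X j; y \<in> X j\<rbrakk> \<Longrightarrow> f x = f y"
  shows "card (f ` V) \<le> t + card (X (t+1))"
proof -
  have "f ` V = (\<Union>j\<in>{1..t}. f ` X j) \<union> f ` X (t+1)"
    unfolding cover[symmetric] by (auto simp: atLeastAtMostSuc_conv)
  then have "card (f ` V) \<le> card (\<Union>j\<in>{1..t}. f ` X j) + card (f ` X (t+1))"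
    by (simp add: card_Un_le)
  also have "card (\<Union>j\<in>{1..t}. f ` X j) \<le> (\<Sum>j\<in>{1..t}. card (f ` X j))"
    by (intro card_UN_le) simp
  also have "\<dots> \<le> (\<Sum>j\<in>{1..t}. 1)"
    by (intro sum_mono) (use card_image_const[of _ f] assms in blast)
  also have "card (f ` X (t+1)) \<le> card (X (t+1))"
    using finite_subset[OF part_subset finite_V] by (intro card_image_le) auto
  finally show ?thesis by simp
qed

text \<open>With so many vertices left, some part among \<open>X 1, ..., X t\<close> is not yet a
  single vertex. The least such part absorbs one more vertex: it is either the current part
  \<open>X i\<close>, or a later one if \<open>X i\<close> is finished.\<close>

lemma phase_step:
  assumes ph: "phase f i A" and big: "\<not> card (f ` V) \<le> t + card (X (t+1))"
  shows "\<exists>u\<in>f ` V. \<exists>v\<in>f ` V. u \<noteq> v \<and> (\<exists>j B. phase (merge u v f) j B)"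
proof -
  note p = phaseD[OF ph]
  let ?N = "\<lambda>j. j \<in> {1..t} \<and> (\<exists>x\<in>X j. \<exists>y\<in>X j. f x \<noteq> f y)"
  have "\<exists>j. ?N j" using card_image_if_const[of f] big by blast
  then obtain j where N: "?N j" and least: "\<And>k. k < j \<Longrightarrow> \<not> ?N k"
    using exists_least_iff[of ?N] by blast
  have j: "j \<in> {1..t}" using N by blast
  have XV: "X j \<subseteq> V" using j by (intro part_subset) auto
  have const: "f x = f y" if "k \<in> {1..<i}" "x \<in> X k" "y \<in> X k" for k x y
  proof -
    have "X k \<subseteq> V" using that(1) p(1) by (intro part_subset) auto
    then show ?thesis using p(4)[of x y] that by blast
  qed
  have ij: "i \<le> j"
    using N const by (meson atLeastAtMost_iff atLeastLessThan_iff not_less)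
  \<comment> \<open>The portion of \<open>X j\<close> contracted so far; a part after
    \<open>X i\<close> is still untouched.\<close>
  define B where "B = (if j = i then A else {})"
  have BX: "B \<subseteq> X j" using p(2) by (auto simp: B_def)
  have rel: "f x = f y \<longleftrightarrow> x = y \<or> (\<exists>k\<in>{1..<j}. x \<in> X k \<and> y \<in> X k) \<or> (x \<in> B \<and> y \<in> B)"
    if xy: "x \<in> V" "y \<in> V" for x y
  proof (cases "j = i")
    case False
    then have "i < j" using ij by simp
    have const': "f x = f y" if "k \<in> {1..<j}" "x \<in> X k" "y \<in> X k" for k
    proof -
      have "k < j" "k \<in> {1..t}" using that(1) j by auto
      then show ?thesis using least[of k] that(2,3) by blast
    qed
    \<comment> \<open>\<open>X i\<close> now counts as finished, so pairs identified through
      \<open>A\<close> are covered by the index \<open>i\<close>.\<close>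
    have "i \<in> {1..<j}" using \<open>i < j\<close> p(1) by auto
    then have "\<exists>k\<in>{1..<j}. x \<in> X k \<and> y \<in> X k" if "f x = f y" "x \<noteq> y"
      using p(4)[OF xy] that p(2) \<open>i < j\<close> by fastforce
    moreover have "B = {}" using False by (simp add: B_def)
    ultimately show ?thesis using const' by blast
  qed (use p(4)[OF xy] in \<open>simp add: B_def\<close>)
  obtain u v where uv: "u \<in> X j" "v \<in> X j" "v \<notin> B" "f u \<noteq> f v" "B = {} \<or> u \<in> B"
  proof (cases "B = {}")
    case True
    then show ?thesis using N that by blast
  next
    case False
    then obtain u where u: "u \<in> B" by blast
    \<comment> \<open>By \<open>rel\<close> the map \<open>f\<close> is constant on
      \<open>B\<close>, but by the choice of \<open>j\<close> it is not constant on
      \<open>X j\<close>.\<close>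
    have "\<not> X j \<subseteq> B" using N rel XV by blast
    then obtain v where v: "v \<in> X j" "v \<notin> B" by blast
    have "f u \<noteq> f v"
    proof
      assume "f u = f v"
      then obtain k where "k \<in> {1..<j}" "v \<in> X k"
        using rel[of u v] u v BX XV by blast
      then show False using part_unique[of v k j] v j by auto
    qed
    then show ?thesis using that u v BX by blast
  qed
  have low: "x \<notin> X k" if "x \<in> X j" "k \<in> {1..<j}" for x k
    using part_unique[of x k j] that j by auto
  \<comment> \<open>The vertex \<open>v\<close> is alone in its fibre, and the fibre of
    \<open>u\<close> is \<open>insert u B\<close>. Their union is the new contracted
    portion.\<close>
  have fv: "f x = f v \<longleftrightarrow> x = v" if "x \<in> V" for x
    using rel[OF that, of v] uv low XV by blast
  have fu: "f x = f u \<longleftrightarrow> x = u \<or> x \<in> B" if "x \<in> V" for x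
    using rel[OF that, of u] uv low XV by blast
  have "phase (merge (f u) (f v) f) j (insert u (insert v B))"
    unfolding phase_def
  proof (intro conjI ballI)
    show "insert u (insert v B) \<subseteq> X j" using uv BX by blast
    fix x y assume xy: "x \<in> V" "y \<in> V"
    have "merge (f u) (f v) f x = merge (f u) (f v) f y \<longleftrightarrow>
        f x = f y \<or> (f x \<in> {f u, f v} \<and> f y \<in> {f u, f v})"
      by (auto simp: merge_def)
    also have "\<dots> \<longleftrightarrow> f x = f y \<or>
        (x \<in> insert u (insert v B) \<and> y \<in> insert u (insert v B))"
      using fu[OF xy(1)] fu[OF xy(2)] fv[OF xy(1)] fv[OF xy(2)] by auto
    also have "\<dots> \<longleftrightarrow> x = y \<or> (\<exists>k\<in>{1..<j}. x \<in> X k \<and> y \<in> X k) \<or>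
        (x \<in> insert u (insert v B) \<and> y \<in> insert u (insert v B))"
      using rel[OF xy] by blast
    finally show "merge (f u) (f v) f x = merge (f u) (f v) f y \<longleftrightarrow>
        x = y \<or> (\<exists>k\<in>{1..<j}. x \<in> X k \<and> y \<in> X k) \<or>
        (x \<in> insert u (insert v B) \<and> y \<in> insert u (insert v B))" .
  qed (use j in simp)
  then show ?thesis using uv XV by blast
qed

lemma phase_id:
  assumes "t \<noteq> 0"
  shows "phase (\<lambda>x. x) 1 {}"
  using assms by (simp add: phase_def)

text \<open>The invariant says that few vertices are left or that a phase is in progress. In the
  first case the red degree is bounded by the number of vertices and any merge preserves the
  invariant.\<close>

lemma tww_le: "tww V E \<le> t + max g (card (X (t+1)))"
proof (rule tww_le_if_merges[OF graph,
      where P = "\<lambda>f. card (f ` V) \<le> t + card (X (t+1)) \<or> (\<exists>i A. phase f i A)"])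
  let ?b = "card (X (t+1))"
  fix f assume f: "card (f ` V) \<le> t + ?b \<or> (\<exists>i A. phase f i A)"
  show "\<exists>u\<in>f ` V. \<exists>v\<in>f ` V. u \<noteq> v \<and>
      (card (merge u v f ` V) \<le> t + ?b \<or> (\<exists>i A. phase (merge u v f) i A))"
    if two: "card (f ` V) \<ge> 2"
  proof (cases "card (f ` V) \<le> t + ?b")
    case True
    obtain U where "U \<subseteq> f ` V" "card U = 2"
      using obtain_subset_with_card_n[OF two] by blast
    then obtain u v where uv: "u \<in> f ` V" "v \<in> f ` V" "u \<noteq> v"
      unfolding card_2_iff by blast
    then have "card (merge u v f ` V) \<le> t + ?b"
      using card_merge_image[OF finite_V uv] True by simp
    then show ?thesis using uv by blast
  next
    case False
    then show ?thesis using f phase_step by blast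
  qed
  show "red_degree (quotient_trigraph V E f) a \<le> t + max g ?b" if a: "a \<in> f ` V" for a
  proof (cases "card (f ` V) \<le> t + ?b")
    case True
    have "red_degree (quotient_trigraph V E f) a \<le> card (f ` V)"
      by (rule red_degree_quotient_le)
        (use finite_V in \<open>auto simp: red_edge_quotient_iff\<close>)
    then show ?thesis using True by simp
  next
    case False
    then have "red_degree (quotient_trigraph V E f) a \<le> t + g"
      using f phase_red_degree[OF _ a] by blast
    then show ?thesis by simp
  qed
next
  show "card ((\<lambda>x. x) ` V) \<le> t + card (X (t+1)) \<or> (\<exists>i A. phase (\<lambda>x. x) i A)"
    \<comment> \<open>For \<open>t = 0\<close> there is no phase, but then \<open>V = X 1\<close>
      and the vertex bound holds from the start.\<close>
    using phase_id cover by (cases "t = 0") auto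
qed

end

theorem theorem3p1:
  fixes \<alpha> \<beta> \<gamma> :: real
    and V :: "'a set" and E :: "'a set set"
    and t :: nat and X :: "nat \<Rightarrow> 'a set"
  assumes "\<alpha> \<ge> 0" and "\<beta> \<ge> 0" and "\<gamma> \<ge> 0"
    and "simple_graph V E"
    and "disjoint_family_on X {1..t+1}"
    and "(\<Union>i\<in>{1..t+1}. X i) = V"
    and "real t \<le> \<alpha>"
    and "real (card (X (t+1))) \<le> \<beta>"
    and "\<forall>i\<in>{1..t}. real (card {v \<in> (\<Union>j\<in>{i..t+1}. X j). mixed_on E v (X i)}) \<le> \<gamma>"
  shows "real (tww V E) \<le> \<alpha> + max \<gamma> \<beta>"
proof -
  \<comment> \<open>Cardinalities are integers, so bounding them by \<gamma> amounts to bounding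
    them by its floor.\<close>
  interpret partitioned_graph V E t "nat \<lfloor>\<gamma>\<rfloor>" X
    using assms by unfold_locales (auto simp: le_nat_floor)
  have "real (tww V E) \<le> real t + max (real (nat \<lfloor>\<gamma>\<rfloor>)) (real (card (X (t+1))))"
    using tww_le by (metis of_nat_add of_nat_le_iff of_nat_max)
  also have "\<dots> \<le> \<alpha> + max \<gamma> \<beta>"
    using assms(3,7,8) by (intro add_mono max.mono) auto
  finally show ?thesis .
qed

end
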